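(* Let $P \subset \mathbb{R}^d$ be a $d$-dimensional rational polytope and let $a$ be a rational vector in the interior of $P$. Then, pointwise for every positive real $t$, $$L_P(t) = \lim_{\tau \to 0^+} A_{P, \tau (P-a)}(t).$$ Furthermore, for all $0 \leq k \leq d$ and every positive real $t$, $$e_k(P;t) = \lim_{\tau \to 0^+} a_k(P, \tau (P-a); t).$$
   Context: A polytope is the convex hull of finitely many points; it is rational if its vertices have rational coordinates; its denominator $m$ is the smallest positive integer such that $mP$ has integer vertices. $tP=\{tx:x\in P\}$, $P-a=\{x-a:x\in P\}$, and $P+R=\{x+y:x\in P,y\in R\}$ is the Minkowski sum. Ehrhart function: $L_P(t)=|tP\cap\mathbb{Z}^d|$ for real $t>0$. There are unique functions $e_k(P;\cdot)$, $0\le k\le d$, on $(0,\infty)$ with $e_k(P;t+m)=e_k(P;t)$ and $L_P(t)=\sum_{k=0}^de_k(P;t)t^k$ for all real $t>0$. Solid angle: $\omega_Q(x)=\lim_{\epsilon\to0^+}\mathrm{vol}(B(x,\epsilon)\cap Q)/\mathrm{vol}(B(x,\epsilon))$, with $B(x,\epsilon)$ the ball of center $x$, radius $\epsilon$. For $d$-dimensional polytopes $P,R\subset\mathbb{R}^d$ with $P$ rational of denominator $m$, the shifted solid angle sum is $A_{P,R}(t)=\sum_{x\in\mathbb{Z}^d}\omega_{tP+R}(x)$ for real $t>0$. There are unique functions $a_k(P,R;\cdot)$, $0\le k\le d$, on $(0,\infty)$ with $a_k(P,R;t+m)=a_k(P,R;t)$ and $A_{P,R}(t)=\sum_{k=0}^da_k(P,R;t)t^k$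 for all real $t>0$ (the period $m$ does not depend on $R$). *)

theory Defs
  imports "HOL-Analysis.Analysis" "HOL-Library.Set_Algebras"
begin

definition int_lattice :: "(real ^ 'n) set" where
  "int_lattice = {x. \<forall>i. x $ i \<in> \<int>}"

definition rational_vector :: "real ^ 'n \<Rightarrow> bool" where
  "rational_vector x \<longleftrightarrow> (\<forall>i. x $ i \<in> \<rat>)"

abbreviation dilate :: "real \<Rightarrow> (real ^ 'n) set \<Rightarrow> (real ^ 'n) set" where
  "dilate t P \<equiv> (\<lambda>x. t *\<^sub>R x) ` P"

definition rational_polytope :: "(real ^ 'n) set \<Rightarrow> bool" where
  "rational_polytope P \<longleftrightarrow> polytope P \<and> (\<forall>v. v extreme_point_of P \<longrightarrow> rational_vector v)"

definition denominator :: "(real ^ 'n) set \<Rightarrow> nat" where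
  "denominator P =
     (LEAST m. 0 < m \<and> (\<forall>v. v extreme_point_of (dilate (real m) P) \<longrightarrow> v \<in> int_lattice))"

definition ehrhart :: "(real ^ 'n) set \<Rightarrow> real \<Rightarrow> real" where
  "ehrhart P t = real (card (dilate t P \<inter> int_lattice))"

definition solid_angle :: "(real ^ 'n) set \<Rightarrow> real ^ 'n \<Rightarrow> real" where
  "solid_angle Q x =
     Lim (at_right 0) (\<lambda>\<epsilon>. measure lebesgue (ball x \<epsilon> \<inter> Q) / measure lebesgue (ball x \<epsilon>))"

text \<open>Here \<open>+\<close> is the Minkowski sum. For polytopes the sum over the lattice has finite support.\<close>

definition solid_angle_sum :: "(real ^ 'n) set \<Rightarrow> (real ^ 'n) set \<Rightarrow> real \<Rightarrow> real" where
  "solid_angle_sum P R t = (\<Sum>\<^sub>\<infinity>x\<in>int_lattice. solid_angle (dilate t P + R) x)"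

text \<open>The coefficient functions of \<open>F\<close>, viewed as a quasi-polynomial of degree at most \<open>d\<close> and
  period \<open>m\<close> on the positive reals. The coefficients only matter for \<open>k \<le> d\<close> and \<open>t > 0\<close>;
  they are set to \<open>0\<close> elsewhere so that the definite description can denote.\<close>

definition quasi_coeff :: "nat \<Rightarrow> real \<Rightarrow> (real \<Rightarrow> real) \<Rightarrow> nat \<Rightarrow> real \<Rightarrow> real" where
  "quasi_coeff d m F =
     (THE c. (\<forall>k\<le>d. \<forall>t>0. c k (t + m) = c k t) \<and>
             (\<forall>t>0. F t = (\<Sum>k\<le>d. c k t * t ^ k)) \<and>
             (\<forall>k t. d < k \<or> t \<le> 0 \<longrightarrow> c k t = 0))"

definition ehrhart_coeff :: "(real ^ 'n) set \<Rightarrow> nat \<Rightarrow> real \<Rightarrow> real" where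
  "ehrhart_coeff P = quasi_coeff CARD('n) (real (denominator P)) (ehrhart P)"

text \<open>The period is the denominator of \<open>P\<close> alone, whatever \<open>R\<close> is.\<close>

definition solid_angle_coeff :: "(real ^ 'n) set \<Rightarrow> (real ^ 'n) set \<Rightarrow> nat \<Rightarrow> real \<Rightarrow> real" where
  "solid_angle_coeff P R =
     quasi_coeff CARD('n) (real (denominator P)) (solid_angle_sum P R)"

end

theory Submission
  imports Defs "HOL-Computational_Algebra.Polynomial"
begin

text \<open>The first limit is reached at a positive \<open>\<tau>\<close>: for a fixed \<open>t\<close> and all small \<open>\<tau>\<close> the lattice points of
  \<open>t P\<close> lie in the interior of \<open>t P + \<tau> (P - a)\<close>, where the solid angle is \<open>1\<close>, and all other lattice
  points lie outside of it (lemma \<open>eventually_solid_angle_sum_eq_ehrhart\<close>).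

  For the coefficients it suffices to know that both counting functions are quasi-polynomials of
  period \<open>m\<close> and degree at most \<open>d\<close>, because then the coefficients at \<open>t\<close> are fixed linear combinations of
  the values at \<open>t, t + m, \<dots>, t + dm\<close> (lemma \<open>tendsto_quasi_coeff\<close>). Being such a quasi-polynomial means
  that the differences of order \<open>d + 1\<close> along each progression \<open>t + n m\<close> vanish, a condition that is
  linear and stable under averages and limits.

  For the lattice point count of the real dilates \<open>(s + n) Q\<close>, \<open>s > 0\<close>, of a lattice polytope
  \<open>Q = m P\<close>, translated by an arbitrary real vector, consider the cone over \<open>Q\<close>. Each of its points has
  a unique lexicographically smallest representation as a nonnegative combination of the vertices.
  The supports of these representations are linearly independent, and all representations with such a
  support are again smallest. The count therefore splits into counts of positive coefficient vectors
  on sets of at most \<open>d + 1\<close> vertices. Adding \<open>1\<close> to a coefficient leads from level \<open>n\<close> to level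
  \<open>n + 1\<close>, so each difference confines one more coefficient to \<open>(0, 1]\<close>; when all of them are confined,
  nothing is left (lemma \<open>fdiff_card_cone_slices\<close>).

  The solid angle sum of a compact convex set is the limit, as \<open>\<epsilon>\<close> tends to \<open>0\<close>, of the average number of
  points that the set contains of the lattice translated by a vector of length less than \<open>\<epsilon>\<close>. Since
  \<open>t P + \<tau> (P - a) = (t + \<tau>) P - \<tau> a\<close>, its differences vanish because those of the translated counts do
  (lemma \<open>fdiff_lattice_angle_sum_eq_0\<close>).\<close>

section \<open>Finite differences and coefficients of quasi-polynomials\<close>

text \<open>The forward difference operator on real sequences.\<close>

definition fdiff :: "(nat \<Rightarrow> real) \<Rightarrow> nat \<Rightarrow> real" where
  "fdiff f n = f (Suc n) - f n"

lemma fdiff_funpow_Suc: "(fdiff ^^ Suc k) f n = (fdiff ^^ k) f (Suc n) - (fdiff ^^ k) f n"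
  by (simp add: fdiff_def)

lemma fdiff_funpow_zero: "(fdiff ^^ k) (\<lambda>_. 0) = (\<lambda>_. 0)"
  by (induction k) (auto simp: fdiff_def fun_eq_iff)

lemma fdiff_funpow_sum:
  "(fdiff ^^ k) (\<lambda>n. \<Sum>i\<in>I. f i n) = (\<lambda>n. \<Sum>i\<in>I. (fdiff ^^ k) (f i) n)"
  by (induction k) (auto simp: fdiff_def fun_eq_iff sum_subtractf)

lemma fdiff_funpow_eq_0_mono:
  assumes "(fdiff ^^ k) f = (\<lambda>_. 0)" and "k \<le> l"
  shows "(fdiff ^^ l) f = (\<lambda>_. 0)"
proof -
  have "(fdiff ^^ l) f = (fdiff ^^ (l - k)) ((fdiff ^^ k) f)"
    using assms(2) by (metis comp_apply funpow_add le_add_diff_inverse2)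
  then show ?thesis
    by (simp add: assms(1) fdiff_funpow_zero)
qed

lemma tendsto_fdiff_funpow:
  assumes "\<And>n. ((\<lambda>x. f x n) \<longlongrightarrow> g n) X"
  shows "((\<lambda>x. (fdiff ^^ k) (f x) n) \<longlongrightarrow> (fdiff ^^ k) g n) X"
proof (induction k arbitrary: n)
  case (Suc k)
  then show ?case
    unfolding fdiff_funpow_Suc by (intro tendsto_diff)
qed (simp add: assms)

text \<open>Newton's forward difference formula. The bound \<open>N\<close> is left free: the terms with \<open>k > n\<close>
  vanish, and a common range for \<open>n\<close> and \<open>n + 1\<close> makes the induction go through.\<close>

lemma newton_forward:
  assumes "n \<le> N"
  shows "f n = (\<Sum>k\<le>N. real (n choose k) * (fdiff ^^ k) f 0)"
  using assms
proof (induction n arbitrary: f)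
  case 0
  have "(\<Sum>k\<le>N. real (0 choose k) * (fdiff ^^ k) f 0) = (\<Sum>k\<in>{0}. real (0 choose k) * (fdiff ^^ k) f 0)"
    by (intro sum.mono_neutral_right) auto
  then show ?case by simp
next
  case (Suc n)
  then obtain M where M: "N = Suc M" "n \<le> M"
    by (cases N) auto
  have s1: "(\<Sum>k\<le>N. real (n choose k) * (fdiff ^^ k) f 0)
      = f 0 + (\<Sum>k\<le>M. real (n choose Suc k) * (fdiff ^^ Suc k) f 0)"
    unfolding M(1) sum.atMost_Suc_shift by simp
  have "(\<Sum>k\<le>N. real (n choose k) * (fdiff ^^ k) (fdiff f) 0)
      = (\<Sum>k\<le>M. real (n choose k) * (fdiff ^^ Suc k) f 0)"
    unfolding M(1) using M(2) by (simp add: funpow_swap1 del: funpow.simps) (simp add: funpow_swap1)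
  with s1 have "f n + fdiff f n
      = f 0 + (\<Sum>k\<le>M. real (Suc n choose Suc k) * (fdiff ^^ Suc k) f 0)"
    using Suc.IH[of f] Suc.IH[of "fdiff f"] Suc.prems
    by (simp add: sum.distrib algebra_simps del: funpow.simps)
  then show ?case
    unfolding M(1) sum.atMost_Suc_shift by (simp add: fdiff_def del: binomial_Suc_Suc)
qed

text \<open>The polynomial of degree at most \<open>k\<close> with value \<open>n choose k\<close> at \<open>t + n m\<close>, for \<open>m \<noteq> 0\<close>.\<close>

definition step_poly :: "real \<Rightarrow> real \<Rightarrow> nat \<Rightarrow> real poly" where
  "step_poly t m k = smult (1 / fact k) (\<Prod>i<k. [:- t / m - real i, 1 / m:])"

lemma poly_step_poly:
  assumes "m \<noteq> 0"
  shows "poly (step_poly t m k) (t + real n * m) = real (n choose k)"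
proof -
  have "poly (step_poly t m k) (t + real n * m) = (\<Prod>i<k. real n - real i) / fact k"
    using assms by (simp add: step_poly_def poly_prod add_divide_distrib algebra_simps)
  also have "\<dots> = real (n choose k)"
    unfolding binomial_gbinomial gbinomial_prod_rev by (simp add: atLeast0LessThan)
  finally show ?thesis .
qed

lemma degree_step_poly: "degree (step_poly t m k) \<le> k"
proof -
  have "degree (\<Prod>i<k. [:- t / m - real i, 1 / m:]) \<le> (\<Sum>i<k. degree [:- t / m - real i, 1 / m:])"
    using degree_prod_sum_le[of "{..<k}" "\<lambda>i. [:- t / m - real i, 1 / m:]"] by (simp add: o_def)
  also have "\<dots> \<le> (\<Sum>i<k. 1)"
    by (intro sum_mono) auto
  finally show ?thesis
    using degree_smult_le le_trans unfolding step_poly_def by fastforce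
qed

lemma poly_eqI_progression:
  fixes p q :: "real poly"
  assumes "m > 0" and "\<And>n. poly p (t + real n * m) = poly q (t + real n * m)"
  shows "p = q"
proof (rule ccontr)
  assume "p \<noteq> q"
  then have "finite {x. poly (p - q) x = 0}"
    by (intro poly_roots_finite) simp
  moreover have "range (\<lambda>n. t + real n * m) \<subseteq> {x. poly (p - q) x = 0}"
    using assms(2) by auto
  moreover have "inj (\<lambda>n. t + real n * m)"
    using assms(1) by (auto simp: inj_on_def)
  ultimately show False
    using finite_subset range_inj_infinite by blast
qed

text \<open>The polynomial that interpolates \<open>F\<close> along the progression \<open>t, t + m, t + 2m, \<dots>\<close> when the
  differences of order \<open>d + 1\<close> of \<open>F\<close> along it vanish.\<close>

definition newton_poly :: "nat \<Rightarrow> real \<Rightarrow> (real \<Rightarrow> real) \<Rightarrow> real \<Rightarrow> real poly" where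
  "newton_poly d m F t =
     (\<Sum>j\<le>d. smult ((fdiff ^^ j) (\<lambda>n. F (t + real n * m)) 0) (step_poly t m j))"

lemma degree_newton_poly: "degree (newton_poly d m F t) \<le> d"
  unfolding newton_poly_def
  by (intro degree_sum_le) (auto intro: degree_smult_le[THEN le_trans] degree_step_poly[THEN le_trans])

lemma poly_newton_poly:
  assumes "m > 0" and "(fdiff ^^ Suc d) (\<lambda>n. F (t + real n * m)) = (\<lambda>_. 0)"
  shows "poly (newton_poly d m F t) (t + real n * m) = F (t + real n * m)"
proof -
  let ?f = "\<lambda>n. F (t + real n * m)"
  have "?f n = (\<Sum>k\<le>max n d. real (n choose k) * (fdiff ^^ k) ?f 0)"
    by (rule newton_forward) simp
  also have "\<dots> = (\<Sum>k\<le>d. real (n choose k) * (fdiff ^^ k) ?f 0)"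
  proof (rule sum.mono_neutral_right)
    show "\<forall>k\<in>{..max n d} - {..d}. real (n choose k) * (fdiff ^^ k) ?f 0 = 0"
      using fdiff_funpow_eq_0_mono[OF assms(2)] by auto
  qed auto
  also have "\<dots> = poly (newton_poly d m F t) (t + real n * m)"
    unfolding newton_poly_def poly_sum poly_smult
    using assms(1) by (subst poly_step_poly) (simp_all add: mult_ac)
  finally show ?thesis by simp
qed

text \<open>Existence and uniqueness of the coefficient functions. On a progression of step \<open>m\<close> the
  coefficients are constant, so there \<open>F\<close> is an honest polynomial, and a polynomial is determined
  by its values on a progression.\<close>

lemma quasi_coeff_eq_coeff_newton_poly:
  assumes m: "m > 0"
    and fd: "\<And>t. t > 0 \<Longrightarrow> (fdiff ^^ Suc d) (\<lambda>n. F (t + real n * m)) = (\<lambda>_. 0)"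
    and k: "k \<le> d" and t: "t > 0"
  shows "quasi_coeff d m F k t = coeff (newton_poly d m F t) k"
proof -
  let ?q = "newton_poly d m F"
  define c where "c = (\<lambda>k t. if k \<le> d \<and> t > 0 then coeff (?q t) k else 0)"
  have q: "poly (?q t) (t + real n * m) = F (t + real n * m)" if "t > 0" for t n
    using poly_newton_poly[OF m fd[OF that]] .
  have expand: "poly p x = (\<Sum>k\<le>d. coeff p k * x ^ k)" if "degree p \<le> d" for p :: "real poly" and x
    unfolding poly_altdef using that
    by (intro sum.mono_neutral_left) (auto simp: coeff_eq_0)
  have per: "?q (t + m) = ?q t" if "t > 0" for t
  proof (rule poly_eqI_progression[OF m, where t = "t + m"])
    fix n
    have *: "t + m + real n * m = t + real (Suc n) * m"
      by (simp add: algebra_simps)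
    show "poly (?q (t + m)) (t + m + real n * m) = poly (?q t) (t + m + real n * m)"
      using q[of "t + m" n] q[of t "Suc n"] that m unfolding * by simp
  qed
  have "quasi_coeff d m F = c"
    unfolding quasi_coeff_def
  proof (rule the_equality, intro conjI allI impI)
    fix k :: nat and t :: real
    assume "k \<le> d" "t > 0"
    then show "c k (t + m) = c k t"
      using m per by (simp add: c_def)
  next
    fix t :: real
    assume t: "t > 0"
    show "F t = (\<Sum>k\<le>d. c k t * t ^ k)"
      using q[OF t, of 0] t expand[OF degree_newton_poly, of m F t t] by (simp add: c_def)
  next
    fix k :: nat and t :: real
    assume "d < k \<or> t \<le> 0"
    then show "c k t = 0" by (auto simp: c_def)
  next
    fix c'
    assume c': "(\<forall>k\<le>d. \<forall>t>0. c' k (t + m) = c' k t) \<and>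
             (\<forall>t>0. F t = (\<Sum>k\<le>d. c' k t * t ^ k)) \<and>
             (\<forall>k t. d < k \<or> t \<le> 0 \<longrightarrow> c' k t = 0)"
    have "c' k t = c k t" if kt: "k \<le> d" "t > 0" for k t
    proof -
      have shift: "c' i (t + real n * m) = c' i t" if "i \<le> d" for i n
      proof (induction n)
        case (Suc n)
        have "c' i (t + real n * m + m) = c' i (t + real n * m)"
          using c' that kt m by (metis add_pos_nonneg less_imp_le mult_nonneg_nonneg of_nat_0_le_iff)
        then show ?case using Suc by (simp add: algebra_simps)
      qed simp
      let ?p = "\<Sum>i\<le>d. monom (c' i t) i"
      \<comment> \<open>along \<open>t, t + m, \<dots>\<close> the competitor is the polynomial \<open>?p\<close> with constant coefficients\<close>
      have "?p = ?q t"
      proof (rule poly_eqI_progression[OF m])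
        fix n
        have "t + real n * m > 0" using kt m by (simp add: add_pos_nonneg)
        then have "F (t + real n * m) = (\<Sum>i\<le>d. c' i (t + real n * m) * (t + real n * m) ^ i)"
          using c' by blast
        then show "poly ?p (t + real n * m) = poly (?q t) (t + real n * m)"
          using q[OF kt(2), of n] shift by (simp add: poly_sum poly_monom)
      qed
      then have "coeff (?q t) k = coeff ?p k" by simp
      also have "\<dots> = c' k t"
        using kt by (simp add: coeff_sum sum.delta)
      finally show ?thesis using kt by (simp add: c_def)
    qed
    moreover have "c' k t = c k t" if "\<not> (k \<le> d \<and> t > 0)" for k t
      using c' that by (auto simp: c_def not_le not_less)
    ultimately show "c' = c" by (intro ext) blast
  qed
  then show ?thesis using k t by (simp add: c_def)
qed

text \<open>The coefficients at \<open>t\<close> are fixed linear combinations of the values at \<open>t, t + m, \<dots>, t + dm\<close>,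
  hence they depend continuously on pointwise limits.\<close>

lemma tendsto_quasi_coeff:
  assumes m: "m > 0"
    and F: "eventually (\<lambda>x. \<forall>t>0. (fdiff ^^ Suc d) (\<lambda>n. F x (t + real n * m)) = (\<lambda>_. 0)) X"
    and G: "\<And>t. t > 0 \<Longrightarrow> (fdiff ^^ Suc d) (\<lambda>n. G (t + real n * m)) = (\<lambda>_. 0)"
    and lim: "\<And>t. t > 0 \<Longrightarrow> ((\<lambda>x. F x t) \<longlongrightarrow> G t) X"
    and k: "k \<le> d" and t: "t > 0"
  shows "((\<lambda>x. quasi_coeff d m (F x) k t) \<longlongrightarrow> quasi_coeff d m G k t) X"
proof -
  have "((\<lambda>x. (fdiff ^^ j) (\<lambda>n. F x (t + real n * m)) 0)
      \<longlongrightarrow> (fdiff ^^ j) (\<lambda>n. G (t + real n * m)) 0) X" for j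
    using m t by (intro tendsto_fdiff_funpow lim) (simp add: add_pos_nonneg)
  then have "((\<lambda>x. coeff (newton_poly d m (F x) t) k) \<longlongrightarrow> coeff (newton_poly d m G t) k) X"
    unfolding newton_poly_def coeff_sum coeff_smult by (intro tendsto_intros)
  moreover have "eventually (\<lambda>x. quasi_coeff d m (F x) k t = coeff (newton_poly d m (F x) t) k) X"
    using F by eventually_elim (rule quasi_coeff_eq_coeff_newton_poly[OF m _ k t], simp only:)
  moreover have "quasi_coeff d m G k t = coeff (newton_poly d m G t) k"
    by (rule quasi_coeff_eq_coeff_newton_poly[OF m G k t])
  ultimately show ?thesis
    by (simp only: tendsto_cong)
qed

section \<open>Counting points in finitely generated cones\<close>

text \<open>Whether the vector of the values of \<open>\<gamma>\<close> along the list is lexicographically negative, that is,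
  its first nonzero entry is negative.\<close>

primrec lexneg :: "'a list \<Rightarrow> ('a \<Rightarrow> real) \<Rightarrow> bool" where
  "lexneg [] \<gamma> \<longleftrightarrow> False"
| "lexneg (w # ws) \<gamma> \<longleftrightarrow> \<gamma> w < 0 \<or> (\<gamma> w = 0 \<and> lexneg ws \<gamma>)"

lemma lexneg_cong: "(\<And>w. w \<in> set ws \<Longrightarrow> \<gamma> w = \<delta> w) \<Longrightarrow> lexneg ws \<gamma> \<longleftrightarrow> lexneg ws \<delta>"
  by (induction ws) auto

lemma lexneg_total: "w \<in> set ws \<Longrightarrow> \<gamma> w \<noteq> 0 \<Longrightarrow> lexneg ws \<gamma> \<or> lexneg ws (\<lambda>w. - \<gamma> w)"
  by (induction ws) auto

lemma lexneg_scale: "c > 0 \<Longrightarrow> lexneg ws (\<lambda>w. c * \<gamma> w) \<longleftrightarrow> lexneg ws \<gamma>"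
  by (induction ws) (auto simp: mult_less_0_iff)

text \<open>The representations of \<open>x\<close> as a nonnegative combination of the points of \<open>S\<close>; coefficients
  outside \<open>S\<close> are \<open>0\<close>, so that a representation is determined as a function.\<close>

definition cone_reps :: "'a::euclidean_space set \<Rightarrow> 'a \<Rightarrow> ('a \<Rightarrow> real) set" where
  "cone_reps S x =
     {\<alpha>. (\<forall>w. 0 \<le> \<alpha> w) \<and> (\<forall>w. w \<notin> S \<longrightarrow> \<alpha> w = 0) \<and> (\<Sum>w\<in>S. \<alpha> w *\<^sub>R w) = x}"

text \<open>The lexicographically smallest representation of \<open>x\<close> over the generators \<open>ws\<close>. These
  representations are the fixed choice that replaces a triangulation of the cone.\<close>

definition lexmin_rep :: "'a::euclidean_space list \<Rightarrow> 'a \<Rightarrow> ('a \<Rightarrow> real) \<Rightarrow> bool" where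
  "lexmin_rep ws x \<alpha> \<longleftrightarrow> \<alpha> \<in> cone_reps (set ws) x \<and>
     (\<forall>\<beta>\<in>cone_reps (set ws) x. \<not> lexneg ws (\<lambda>w. \<beta> w - \<alpha> w))"

lemma cone_repsD:
  assumes "\<alpha> \<in> cone_reps S x"
  shows "0 \<le> \<alpha> w" "w \<notin> S \<Longrightarrow> \<alpha> w = 0" "(\<Sum>w\<in>S. \<alpha> w *\<^sub>R w) = x"
  using assms by (simp_all add: cone_reps_def)

lemma lexmin_repD:
  assumes "lexmin_rep ws x \<alpha>"
  shows "\<alpha> \<in> cone_reps (set ws) x"
    and "\<beta> \<in> cone_reps (set ws) x \<Longrightarrow> \<not> lexneg ws (\<lambda>w. \<beta> w - \<alpha> w)"
  using assms unfolding lexmin_rep_def by blast+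

lemma lexmin_rep_support_subset: "lexmin_rep ws x \<alpha> \<Longrightarrow> {w. \<alpha> w \<noteq> 0} \<subseteq> set ws"
  using cone_repsD(2)[OF lexmin_repD(1)] by blast

lemma mem_convex_cone_hull_insert:
  fixes S :: "'a::euclidean_space set"
  shows "x \<in> convex_cone hull (insert p S) \<longleftrightarrow> (\<exists>c\<ge>0. x - c *\<^sub>R p \<in> convex_cone hull S)"
proof -
  have "convex_cone hull {p} = {c *\<^sub>R p |c. c \<ge> 0}"
    by (subst convex_cone_hull_convex_hull_nonempty) auto
  then have "x \<in> convex_cone hull ({p} \<union> S) \<longleftrightarrow>
      (\<exists>c\<ge>0. \<exists>y\<in>convex_cone hull S. x = c *\<^sub>R p + y)"
    unfolding convex_cone_hull_Un by auto
  also have "\<dots> \<longleftrightarrow> (\<exists>c\<ge>0. x - c *\<^sub>R p \<in> convex_cone hull S)"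
    by (metis add_diff_cancel_left' diff_add_cancel add.commute)
  finally show ?thesis by simp
qed

lemma cone_reps_imp_mem_cone:
  assumes "finite S" "\<alpha> \<in> cone_reps S x"
  shows "x \<in> convex_cone hull S"
proof -
  have "(\<Sum>w\<in>T. \<alpha> w *\<^sub>R w) \<in> convex_cone hull S" if "T \<subseteq> S" for T
    using finite_subset[OF that assms(1)] that
  proof (induction T)
    case (insert w T)
    then have "\<alpha> w *\<^sub>R w \<in> convex_cone hull S"
      using assms(2) by (intro convex_cone_hull_mul hull_inc) (auto simp: cone_reps_def)
    then show ?case
      using insert by (simp add: convex_cone_hull_add)
  qed (simp add: convex_cone_hull_contains_0)
  from this[of S] show ?thesis using assms(2) by (auto simp: cone_reps_def)
qed

lemma cone_reps_remove:
  assumes "finite S" "p \<notin> S" "\<beta> \<in> cone_reps (insert p S) x"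
  shows "\<beta>(p := 0) \<in> cone_reps S (x - \<beta> p *\<^sub>R p)"
proof -
  have "(\<Sum>w\<in>S. (\<beta>(p := 0)) w *\<^sub>R w) = (\<Sum>w\<in>S. \<beta> w *\<^sub>R w)"
    using assms(2) by (intro sum.cong) auto
  then show ?thesis using assms by (auto simp: cone_reps_def)
qed

text \<open>The coefficients can be minimised one after the other, because finitely generated cones are
  closed.\<close>

lemma ex_lexmin_rep:
  assumes "distinct ws" "x \<in> convex_cone hull (set ws)"
  shows "\<exists>\<alpha>. lexmin_rep ws x \<alpha>"
  using assms
proof (induction ws arbitrary: x)
  case Nil
  then show ?case by (auto simp: lexmin_rep_def cone_reps_def intro!: exI[of _ "\<lambda>_. 0"])
next
  case (Cons p ws)
  let ?A = "{0..} \<inter> (\<lambda>c. x - c *\<^sub>R p) -` (convex_cone hull (set ws))"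
  have "closed ?A"
    by (intro continuous_closed_vimage closed_Int closed_atLeast continuous_intros
        polyhedron_imp_closed polyhedron_convex_cone_hull) auto
  moreover have "?A \<noteq> {}"
    using Cons.prems(2) mem_convex_cone_hull_insert[of x p "set ws"] by auto
  moreover have bdd: "bdd_below ?A"
    by (rule bdd_belowI[of _ 0]) auto
  ultimately have "Inf ?A \<in> ?A"
    by (intro closed_contains_Inf)
  then obtain c where c: "c \<ge> 0" "x - c *\<^sub>R p \<in> convex_cone hull (set ws)"
    and min: "\<And>b. b \<in> ?A \<Longrightarrow> c \<le> b"
    using cInf_lower[OF _ bdd] by (metis Int_iff atLeast_iff vimageE)
  obtain \<alpha> where \<alpha>: "lexmin_rep ws (x - c *\<^sub>R p) \<alpha>"
    using Cons.IH[OF _ c(2)] Cons.prems(1) by auto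
  have p: "p \<notin> set ws" using Cons.prems(1) by simp
  have "(\<Sum>w\<in>set ws. (\<alpha>(p := c)) w *\<^sub>R w) = (\<Sum>w\<in>set ws. \<alpha> w *\<^sub>R w)"
    using p by (intro sum.cong) auto
  then have mem: "\<alpha>(p := c) \<in> cone_reps (set (p # ws)) x"
    using lexmin_repD(1)[OF \<alpha>] c(1) p by (auto simp: cone_reps_def)
  have "\<not> lexneg (p # ws) (\<lambda>w. \<beta> w - (\<alpha>(p := c)) w)" if \<beta>: "\<beta> \<in> cone_reps (set (p # ws)) x" for \<beta>
  proof
    assume neg: "lexneg (p # ws) (\<lambda>w. \<beta> w - (\<alpha>(p := c)) w)"
    have \<beta>': "\<beta>(p := 0) \<in> cone_reps (set ws) (x - \<beta> p *\<^sub>R p)"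
      using cone_reps_remove[of "set ws" p \<beta> x] p \<beta> by simp
    have "\<beta> p \<in> ?A"
      using cone_reps_imp_mem_cone[OF _ \<beta>'] \<beta> by (simp add: cone_reps_def)
    then have "c \<le> \<beta> p" by (rule min)
    with neg have "\<beta> p = c" "lexneg ws (\<lambda>w. \<beta> w - (\<alpha>(p := c)) w)" by auto
    moreover have "lexneg ws (\<lambda>w. \<beta> w - (\<alpha>(p := c)) w) \<longleftrightarrow> lexneg ws (\<lambda>w. (\<beta>(p := 0)) w - \<alpha> w)"
      using p by (intro lexneg_cong) auto
    ultimately show False
      using lexmin_repD(2)[OF \<alpha>, of "\<beta>(p := 0)"] \<beta>' by metis
  qed
  with mem show ?case unfolding lexmin_rep_def by blast
qed

lemma lexmin_rep_unique:
  assumes "lexmin_rep ws x \<alpha>" "lexmin_rep ws x \<beta>"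
  shows "\<alpha> = \<beta>"
proof (rule ccontr)
  assume "\<alpha> \<noteq> \<beta>"
  then obtain w where w: "\<alpha> w - \<beta> w \<noteq> 0" by (auto simp: fun_eq_iff)
  then have "w \<in> set ws"
    using lexmin_rep_support_subset[OF assms(1)] lexmin_rep_support_subset[OF assms(2)] by force
  from lexneg_total[of w ws "\<lambda>w. \<alpha> w - \<beta> w", OF this w] show False
    using lexmin_repD(2)[OF assms(1) lexmin_repD(1)[OF assms(2)]]
      lexmin_repD(2)[OF assms(2) lexmin_repD(1)[OF assms(1)]] by simp
qed

lemma ex_pos_scale_le:
  fixes \<alpha> \<gamma> :: "'a \<Rightarrow> real"
  assumes "finite S" "\<And>w. w \<in> S \<Longrightarrow> \<alpha> w \<ge> 0" "\<And>w. w \<in> S \<Longrightarrow> \<alpha> w = 0 \<Longrightarrow> \<gamma> w \<ge> 0"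
  shows "\<exists>e>0. \<forall>w\<in>S. \<alpha> w + e * \<gamma> w \<ge> 0"
  using assms
proof (induction S)
  case empty
  then show ?case by (auto intro: exI[of _ 1])
next
  case (insert v S)
  then obtain e where e: "e > 0" "\<forall>w\<in>S. \<alpha> w + e * \<gamma> w \<ge> 0" by auto
  have mono: "\<alpha> w + e' * \<gamma> w \<ge> 0" if "\<alpha> w + e * \<gamma> w \<ge> 0" "0 < e'" "e' \<le> e" "\<alpha> w \<ge> 0" for e e' w
  proof (cases "\<gamma> w \<ge> 0")
    case False
    then have "e * \<gamma> w \<le> e' * \<gamma> w" using that by (intro mult_right_mono_neg) auto
    then show ?thesis using that by linarith
  qed (use that in simp)
  obtain f where f: "f > 0" "\<alpha> v + f * \<gamma> v \<ge> 0"
  proof (cases "\<gamma> v \<ge> 0")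
    case True
    then show ?thesis using that[of 1] insert.prems by simp
  next
    case False
    then have "\<alpha> v > 0" using insert.prems(1,2)[of v] by (cases "\<alpha> v = 0") auto
    then show ?thesis using False by (intro that[of "\<alpha> v / - \<gamma> v"]) (auto simp: field_simps)
  qed
  show ?case
  proof (intro exI conjI ballI)
    show "min e f > 0" using e f by simp
    fix w assume "w \<in> insert v S"
    then show "\<alpha> w + min e f * \<gamma> w \<ge> 0"
      using e f insert.prems(1)[of w] mono[of w e "min e f"] mono[of w f "min e f"] by auto
  qed
qed

text \<open>A representation that is minimal cannot be moved in a lexicographically negative direction \<open>\<gamma>\<close>
  that keeps the represented point and does not decrease coefficients that are \<open>0\<close>: a small
  multiple of \<open>\<gamma>\<close> would keep all coefficients nonnegative.\<close>

lemma lexmin_rep_perturb: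
  assumes "lexmin_rep ws x \<alpha>"
    and "(\<Sum>w\<in>set ws. \<gamma> w *\<^sub>R w) = 0"
    and "\<And>w. w \<notin> set ws \<Longrightarrow> \<gamma> w = 0" "\<And>w. \<alpha> w = 0 \<Longrightarrow> \<gamma> w \<ge> 0"
  shows "\<not> lexneg ws \<gamma>"
proof
  assume neg: "lexneg ws \<gamma>"
  have \<alpha>: "\<alpha> \<in> cone_reps (set ws) x" using assms(1) by (simp add: lexmin_rep_def)
  obtain e where e: "e > 0" "\<forall>w\<in>set ws. \<alpha> w + e * \<gamma> w \<ge> 0"
    using ex_pos_scale_le[of "set ws" \<alpha> \<gamma>] \<alpha> assms(4) by (auto simp: cone_reps_def)
  have "(\<Sum>w\<in>set ws. (\<alpha> w + e * \<gamma> w) *\<^sub>R w) = x + e *\<^sub>R (\<Sum>w\<in>set ws. \<gamma> w *\<^sub>R w)"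
    using \<alpha> by (simp add: cone_reps_def scaleR_add_left sum.distrib scaleR_sum_right)
  moreover have "\<alpha> w + e * \<gamma> w \<ge> 0" for w
    using e \<alpha> assms(3) by (cases "w \<in> set ws") (auto simp: cone_reps_def)
  ultimately have "(\<lambda>w. \<alpha> w + e * \<gamma> w) \<in> cone_reps (set ws) x"
    using \<alpha> assms(2,3) by (auto simp: cone_reps_def)
  then have "\<not> lexneg ws (\<lambda>w. \<alpha> w + e * \<gamma> w - \<alpha> w)"
    by (rule lexmin_repD(2)[OF assms(1)])
  then show False using neg lexneg_scale[OF e(1), of ws \<gamma>] by simp
qed

text \<open>Minimality depends only on the support and passes to smaller supports; the supports thus form a
  simplicial complex on the generators.\<close>

lemma lexmin_rep_support_mono:
  assumes "lexmin_rep ws x \<alpha>" and "\<And>w. \<beta> w \<ge> 0" and "\<And>w. \<alpha> w = 0 \<Longrightarrow> \<beta> w = 0"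
  shows "lexmin_rep ws (\<Sum>w\<in>set ws. \<beta> w *\<^sub>R w) \<beta>"
proof -
  have \<beta>0: "\<beta> w = 0" if "w \<notin> set ws" for w
    using lexmin_rep_support_subset[OF assms(1)] assms(3) that by blast
  have "\<not> lexneg ws (\<lambda>w. \<delta> w - \<beta> w)" if "\<delta> \<in> cone_reps (set ws) (\<Sum>w\<in>set ws. \<beta> w *\<^sub>R w)" for \<delta>
    using that assms(3) \<beta>0
    by (intro lexmin_rep_perturb[OF assms(1)])
       (auto simp: cone_reps_def algebra_simps sum_subtractf)
  then show ?thesis
    using assms(2) \<beta>0 by (auto simp: lexmin_rep_def cone_reps_def)
qed

lemma card_support_lexmin_rep_le:
  fixes ws :: "'a::euclidean_space list"
  assumes "lexmin_rep ws x \<alpha>"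
  shows "card {w. \<alpha> w \<noteq> 0} \<le> DIM('a)"
proof -
  let ?T = "{w. \<alpha> w \<noteq> 0}"
  have sub: "?T \<subseteq> set ws" using lexmin_rep_support_subset[OF assms] .
  then have fin: "finite ?T" using finite_subset by blast
  have "independent ?T"
  proof
    assume "dependent ?T"
    then obtain u v where u: "v \<in> ?T" "u v \<noteq> 0" "(\<Sum>w\<in>?T. u w *\<^sub>R w) = 0"
      using dependent_finite[OF fin] by blast
    \<comment> \<open>a linear dependency gives two opposite directions, one of which is lexicographically negative\<close>
    define \<gamma> where "\<gamma> = (\<lambda>w. if w \<in> ?T then u w else 0)"
    have "(\<Sum>w\<in>set ws. \<gamma> w *\<^sub>R w) = (\<Sum>w\<in>?T. \<gamma> w *\<^sub>R w)"
      using sub by (intro sum.mono_neutral_right) (auto simp: \<gamma>_def)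
    also have "\<dots> = 0" unfolding u(3)[symmetric] by (intro sum.cong) (auto simp: \<gamma>_def)
    finally have sum: "(\<Sum>w\<in>set ws. \<gamma> w *\<^sub>R w) = 0" .
    have out: "\<gamma> w = 0" if "\<alpha> w = 0 \<or> w \<notin> set ws" for w
      using that sub by (auto simp: \<gamma>_def)
    have "\<not> lexneg ws \<gamma>"
      using sum out by (intro lexmin_rep_perturb[OF assms]) auto
    moreover have "\<not> lexneg ws (\<lambda>w. - \<gamma> w)"
      using sum out by (intro lexmin_rep_perturb[OF assms]) (auto simp: sum_negf)
    moreover have "\<gamma> v \<noteq> 0" "v \<in> set ws" using u sub by (auto simp: \<gamma>_def)
    ultimately show False using lexneg_total[of v ws \<gamma>] by simp
  qed
  then show ?thesis using independent_bound by blast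
qed

text \<open>The coefficient vectors with support exactly \<open>T\<close> whose combination lies in \<open>X\<close>, with the
  coefficients indexed by \<open>J\<close> restricted to \<open>(0, 1]\<close>.\<close>

definition open_face_reps ::
  "'a::euclidean_space set \<Rightarrow> 'a set \<Rightarrow> 'a set \<Rightarrow> ('a \<Rightarrow> real) set" where
  "open_face_reps T X J =
     {\<alpha>. (\<forall>w. 0 \<le> \<alpha> w) \<and> {w. \<alpha> w \<noteq> 0} = T \<and> (\<Sum>w\<in>T. \<alpha> w *\<^sub>R w) \<in> X \<and> (\<forall>w\<in>J. \<alpha> w \<le> 1)}"

text \<open>Adding \<open>1\<close> to the coefficient of \<open>w\<close> maps the vectors of level \<open>n\<close> onto those of level \<open>n + 1\<close>
  in which that coefficient exceeds \<open>1\<close>.\<close>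

lemma card_open_face_reps_step:
  assumes fin: "finite T" "finite (open_face_reps T (X (Suc n)) J)"
    and w: "w \<in> T" "w \<notin> J"
    and shift: "\<And>x. x + w \<in> X (Suc n) \<longleftrightarrow> x \<in> X n"
  shows "card (open_face_reps T (X (Suc n)) J) =
    card (open_face_reps T (X n) J) + card (open_face_reps T (X (Suc n)) (insert w J))"
proof -
  let ?G = "open_face_reps T"
  have sum: "(\<Sum>v\<in>T. (\<alpha>(w := \<alpha> w + c)) v *\<^sub>R v) = (\<Sum>v\<in>T. \<alpha> v *\<^sub>R v) + c *\<^sub>R w" for \<alpha> c
  proof -
    have "(\<Sum>v\<in>T. (\<alpha>(w := \<alpha> w + c)) v *\<^sub>R v) = (\<Sum>v\<in>T. \<alpha> v *\<^sub>R v + (if v = w then c *\<^sub>R w else 0))"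
      by (intro sum.cong) (auto simp: algebra_simps)
    then show ?thesis using w fin by (simp add: sum.distrib)
  qed
  have "bij_betw (\<lambda>\<alpha>. \<alpha>(w := \<alpha> w + 1)) (?G (X n) J) {\<alpha> \<in> ?G (X (Suc n)) J. \<alpha> w > 1}"
  proof (rule bij_betw_byWitness[where f' = "\<lambda>\<alpha>. \<alpha>(w := \<alpha> w + (- 1))"])
    have "\<alpha>(w := \<alpha> w + 1) \<in> ?G (X (Suc n)) J \<and> (\<alpha>(w := \<alpha> w + 1)) w > 1" if \<alpha>: "\<alpha> \<in> ?G (X n) J" for \<alpha>
    proof -
      have "\<alpha> w \<noteq> 0" "\<alpha> w \<ge> 0" using \<alpha> w by (auto simp: open_face_reps_def)
      then have "\<alpha> w > 0" "\<alpha> w + 1 \<noteq> 0" by auto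
      then show ?thesis
        using \<alpha> w sum[of \<alpha> 1] shift by (auto simp: open_face_reps_def)
    qed
    then show "(\<lambda>\<alpha>. \<alpha>(w := \<alpha> w + 1)) ` ?G (X n) J \<subseteq> {\<alpha> \<in> ?G (X (Suc n)) J. \<alpha> w > 1}"
      by blast
    have "\<alpha>(w := \<alpha> w + (-1)) \<in> ?G (X n) J" if \<alpha>: "\<alpha> \<in> ?G (X (Suc n)) J" "\<alpha> w > 1" for \<alpha>
    proof -
      have "(\<Sum>v\<in>T. (\<alpha>(w := \<alpha> w + (-1))) v *\<^sub>R v) \<in> X n"
        using \<alpha> shift[of "(\<Sum>v\<in>T. \<alpha> v *\<^sub>R v) - w"] unfolding sum by (auto simp: open_face_reps_def)
      then show ?thesis
        using \<alpha> w by (auto simp: open_face_reps_def)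
    qed
    then show "(\<lambda>\<alpha>. \<alpha>(w := \<alpha> w + (- 1))) ` {\<alpha> \<in> ?G (X (Suc n)) J. \<alpha> w > 1} \<subseteq> ?G (X n) J"
      by blast
  qed auto
  then have "card (?G (X n) J) = card {\<alpha> \<in> ?G (X (Suc n)) J. \<alpha> w > 1}"
    by (rule bij_betw_same_card)
  moreover have "?G (X (Suc n)) J = {\<alpha> \<in> ?G (X (Suc n)) J. \<alpha> w > 1} \<union> ?G (X (Suc n)) (insert w J)"
    by (auto simp: open_face_reps_def)
  moreover have "{\<alpha> \<in> ?G (X (Suc n)) J. \<alpha> w > 1} \<inter> ?G (X (Suc n)) (insert w J) = {}"
    by (auto simp: open_face_reps_def)
  moreover have "finite (?G (X (Suc n)) (insert w J))"
    by (rule finite_subset[OF _ fin(2)]) (auto simp: open_face_reps_def)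
  ultimately show ?thesis
    using fin(2) by (metis (no_types, lifting) card_Un_disjoint finite_Un)
qed

text \<open>Each difference confines one more coefficient to \<open>(0, 1]\<close>. After \<open>card T\<close> differences all of them are
  at most \<open>1\<close>, so the height is at most \<open>card T\<close>, but a point of level \<open>n + card T\<close> is higher.\<close>

lemma fdiff_card_open_face_reps:
  fixes T :: "'a::euclidean_space set"
  assumes fin: "finite T" "\<And>n. finite (open_face_reps T (X n) {})"
    and shift: "\<And>w x n. w \<in> T \<Longrightarrow> x + w \<in> X (Suc n) \<longleftrightarrow> x \<in> X n"
    and h: "linear h" "\<And>w. w \<in> T \<Longrightarrow> h w = 1" "\<And>n x. x \<in> X n \<Longrightarrow> real n < h x"
  shows "(fdiff ^^ card T) (\<lambda>n. real (card (open_face_reps T (X n) {}))) = (\<lambda>_. 0)"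
proof -
  have finJ: "finite (open_face_reps T (X n) J)" for n J
    by (rule finite_subset[OF _ fin(2)[of n]]) (auto simp: open_face_reps_def)
  have "(fdiff ^^ card J) (\<lambda>n. real (card (open_face_reps T (X n) {}))) n =
      real (card (open_face_reps T (X (n + card J)) J))" if "J \<subseteq> T" for J n
    using finite_subset[OF that fin(1)] that
  proof (induction J arbitrary: n)
    case (insert w J)
    have "card (open_face_reps T (X (Suc (n + card J))) J) = card (open_face_reps T (X (n + card J)) J)
        + card (open_face_reps T (X (Suc (n + card J))) (insert w J))"
      using insert by (intro card_open_face_reps_step fin(1) finJ shift) auto
    then show ?case
      using insert unfolding card_insert_disjoint[OF insert(1,2)] fdiff_funpow_Suc by simp
  qed simp
  moreover have "open_face_reps T (X (n + card T)) T = {}" for n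
  proof -
    have False if \<alpha>: "\<alpha> \<in> open_face_reps T (X (n + card T)) T" for \<alpha>
    proof -
      have "h (\<Sum>w\<in>T. \<alpha> w *\<^sub>R w) = (\<Sum>w\<in>T. \<alpha> w)"
        using h(2) by (simp add: linear_sum[OF h(1)] linear_cmul[OF h(1)])
      also have "\<dots> \<le> (\<Sum>w\<in>T. 1)"
        using \<alpha> by (intro sum_mono) (auto simp: open_face_reps_def)
      finally show False
        using h(3)[of "\<Sum>w\<in>T. \<alpha> w *\<^sub>R w" "n + card T"] \<alpha> by (simp add: open_face_reps_def)
    qed
    then show ?thesis by blast
  qed
  ultimately show ?thesis by (simp add: fun_eq_iff)
qed

text \<open>The count of the points at level \<open>n\<close> of a finitely generated cone, for a family \<open>X\<close> of point sets
  that is invariant under the generators, splits according to the support of the minimal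
  representation. A support has at most \<open>DIM('a)\<close> elements.\<close>

lemma fdiff_card_cone_slices:
  fixes S :: "'a::euclidean_space set"
  assumes fin: "finite S" "\<And>n. finite (X n \<inter> convex_cone hull S)"
    and shift: "\<And>w x n. w \<in> S \<Longrightarrow> x + w \<in> X (Suc n) \<longleftrightarrow> x \<in> X n"
    and h: "linear h" "\<And>w. w \<in> S \<Longrightarrow> h w = 1" "\<And>n x. x \<in> X n \<Longrightarrow> real n < h x"
  shows "(fdiff ^^ DIM('a)) (\<lambda>n. real (card (X n \<inter> convex_cone hull S))) = (\<lambda>_. 0)"
proof -
  obtain ws where ws: "distinct ws" "set ws = S"
    using finite_distinct_list[OF fin(1)] by blast
  define faces where "faces = {T. \<exists>x \<alpha>. lexmin_rep ws x \<alpha> \<and> T = {w. \<alpha> w \<noteq> 0}}"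
  define Z where "Z = (\<lambda>n T. {x \<in> X n. \<exists>\<alpha>. lexmin_rep ws x \<alpha> \<and> T = {w. \<alpha> w \<noteq> 0}})"
  have faces_sub: "T \<subseteq> S" if "T \<in> faces" for T
    using that ws lexmin_rep_support_subset unfolding faces_def by blast
  then have fin_faces: "finite faces"
    using finite_subset[of faces "Pow S"] fin(1) by auto
  have fin_face: "finite T" if "T \<in> faces" for T
    using faces_sub[OF that] fin(1) finite_subset by blast
  have Z_sub: "Z n T \<subseteq> X n \<inter> convex_cone hull S" for n T
    unfolding Z_def using ws cone_reps_imp_mem_cone[OF fin(1)] lexmin_repD(1) by blast
  have "X n \<inter> convex_cone hull S = (\<Union>T\<in>faces. Z n T)" for n
  proof -
    have "x \<in> (\<Union>T\<in>faces. Z n T)" if "x \<in> X n" "x \<in> convex_cone hull S" for x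
      using ex_lexmin_rep[OF ws(1), of x] that ws(2) by (auto simp: Z_def faces_def)
    then show ?thesis using Z_sub by blast
  qed
  moreover have "card (\<Union>T\<in>faces. Z n T) = (\<Sum>T\<in>faces. card (Z n T))" for n
  proof (rule card_UN_disjoint[OF fin_faces])
    show "\<forall>T\<in>faces. finite (Z n T)"
      using finite_subset[OF Z_sub fin(2)] by blast
    show "\<forall>T\<in>faces. \<forall>T'\<in>faces. T \<noteq> T' \<longrightarrow> Z n T \<inter> Z n T' = {}"
    proof (intro ballI impI, rule ccontr)
      fix T T' assume "T \<noteq> T'" "Z n T \<inter> Z n T' \<noteq> {}"
      then obtain x \<alpha> \<beta> where "lexmin_rep ws x \<alpha>" "lexmin_rep ws x \<beta>"
        "T = {w. \<alpha> w \<noteq> 0}" "T' = {w. \<beta> w \<noteq> 0}"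
        unfolding Z_def by blast
      with \<open>T \<noteq> T'\<close> show False using lexmin_rep_unique[of ws x \<alpha> \<beta>] by simp
    qed
  qed
  ultimately have card_eq: "real (card (X n \<inter> convex_cone hull S)) = (\<Sum>T\<in>faces. real (card (Z n T)))" for n
    by simp
  have bij: "bij_betw (\<lambda>\<alpha>. \<Sum>w\<in>T. \<alpha> w *\<^sub>R w) (open_face_reps T (X n) {}) (Z n T)" if T: "T \<in> faces" for T n
  proof -
    obtain y \<beta> where \<beta>: "lexmin_rep ws y \<beta>" "T = {w. \<beta> w \<noteq> 0}"
      using T by (auto simp: faces_def)
    have sum_eq: "(\<Sum>w\<in>set ws. \<alpha> w *\<^sub>R w) = (\<Sum>w\<in>T. \<alpha> w *\<^sub>R w)" if "{w. \<alpha> w \<noteq> 0} = T" for \<alpha>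
      using that faces_sub[OF T] ws by (intro sum.mono_neutral_right) auto
    have lm: "lexmin_rep ws (\<Sum>w\<in>T. \<alpha> w *\<^sub>R w) \<alpha>" if "\<alpha> \<in> open_face_reps T (X n) {}" for \<alpha>
      using lexmin_rep_support_mono[OF \<beta>(1), of \<alpha>] that \<beta>(2) sum_eq[of \<alpha>]
      by (auto simp: open_face_reps_def)
    show ?thesis
    proof (rule bij_betwI')
      fix \<alpha> \<alpha>' assume "\<alpha> \<in> open_face_reps T (X n) {}" "\<alpha>' \<in> open_face_reps T (X n) {}"
      then show "(\<Sum>w\<in>T. \<alpha> w *\<^sub>R w) = (\<Sum>w\<in>T. \<alpha>' w *\<^sub>R w) \<longleftrightarrow> \<alpha> = \<alpha>'"
        using lm lexmin_rep_unique by metis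
    next
      fix \<alpha> assume \<alpha>: "\<alpha> \<in> open_face_reps T (X n) {}"
      with lm[OF \<alpha>] show "(\<Sum>w\<in>T. \<alpha> w *\<^sub>R w) \<in> Z n T"
        by (auto simp: Z_def open_face_reps_def)
    next
      fix x assume "x \<in> Z n T"
      then obtain \<alpha> where \<alpha>: "x \<in> X n" "lexmin_rep ws x \<alpha>" "T = {w. \<alpha> w \<noteq> 0}"
        by (auto simp: Z_def)
      then have "\<alpha> \<in> open_face_reps T (X n) {}" "x = (\<Sum>w\<in>T. \<alpha> w *\<^sub>R w)"
        using sum_eq[of \<alpha>] cone_repsD[OF lexmin_repD(1)[OF \<alpha>(2)]] by (auto simp: open_face_reps_def)
      then show "\<exists>\<alpha>\<in>open_face_reps T (X n) {}. x = (\<Sum>w\<in>T. \<alpha> w *\<^sub>R w)" by blast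
    qed
  qed
  have "(fdiff ^^ DIM('a)) (\<lambda>n. real (card (Z n T))) = (\<lambda>_. 0)" if T: "T \<in> faces" for T
  proof -
    have "card T \<le> DIM('a)"
      using T card_support_lexmin_rep_le by (auto simp: faces_def)
    moreover have "finite (open_face_reps T (X n) {})" for n
      using bij_betw_finite[OF bij[OF T]] finite_subset[OF Z_sub fin(2)] by blast
    then have "(fdiff ^^ card T) (\<lambda>n. real (card (open_face_reps T (X n) {}))) = (\<lambda>_. 0)"
      using faces_sub[OF T] fin_face[OF T] shift h by (intro fdiff_card_open_face_reps[where h = h]) auto
    ultimately show ?thesis
      using fdiff_funpow_eq_0_mono bij_betw_same_card[OF bij[OF T]] by simp
  qed
  then show ?thesis
    unfolding card_eq fdiff_funpow_sum by simp
qed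

section \<open>Solid angles and averages of lattice point counts\<close>

lemma int_lattice_add: "x \<in> int_lattice \<Longrightarrow> y \<in> int_lattice \<Longrightarrow> x + y \<in> int_lattice"
  and int_lattice_diff: "x \<in> int_lattice \<Longrightarrow> y \<in> int_lattice \<Longrightarrow> x - y \<in> int_lattice"
  by (auto simp: int_lattice_def)

lemma finite_int_lattice_Int_bounded:
  fixes W :: "(real ^ 'n) set"
  assumes "bounded W"
  shows "finite (int_lattice \<inter> W)"
proof -
  obtain B where B: "\<And>x. x \<in> W \<Longrightarrow> norm x \<le> B"
    using assms unfolding bounded_iff by blast
  let ?I = "{- \<lceil>B\<rceil>..\<lceil>B\<rceil>}"
  have "int_lattice \<inter> W \<subseteq> (\<lambda>f. \<chi> i. real_of_int (f i)) ` (PiE UNIV (\<lambda>_::'n. ?I))"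
  proof
    fix x :: "real ^ 'n" assume x: "x \<in> int_lattice \<inter> W"
    have "\<lfloor>x $ i\<rfloor> \<in> ?I" for i
    proof -
      have "\<bar>x $ i\<bar> \<le> B"
        using x B[of x] component_le_norm_cart[of x i] by force
      then show ?thesis by (simp, linarith)
    qed
    moreover have "x = (\<chi> i. real_of_int \<lfloor>x $ i\<rfloor>)"
      using x by (auto simp: vec_eq_iff int_lattice_def elim!: Ints_cases)
    ultimately show "x \<in> (\<lambda>f. \<chi> i. real_of_int (f i)) ` (PiE UNIV (\<lambda>_::'n. ?I))"
      by (intro image_eqI[where x = "\<lambda>i. \<lfloor>x $ i\<rfloor>"]) auto
  qed
  then show ?thesis
    by (rule finite_subset) (intro finite_imageI finite_PiE; simp)
qed

text \<open>The proportion of the ball of radius \<open>\<epsilon>\<close> around \<open>x\<close> covered by \<open>W\<close>; its limit for \<open>\<epsilon>\<close> tending to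
  \<open>0\<close> from above is the solid angle.\<close>

definition ball_fraction :: "(real ^ 'n) set \<Rightarrow> real ^ 'n \<Rightarrow> real \<Rightarrow> real" where
  "ball_fraction W x \<epsilon> = measure lebesgue (ball x \<epsilon> \<inter> W) / measure lebesgue (ball x \<epsilon>)"

text \<open>Contracting a convex set towards one of its points \<open>x\<close> keeps it inside itself, so it covers a
  larger share of smaller balls around \<open>x\<close>. The solid angle therefore exists as a monotone limit.\<close>

lemma ball_fraction_antimono:
  fixes W :: "(real ^ 'n) set"
  assumes W: "compact W" "convex W" "x \<in> W" and e: "0 < e'" "e' \<le> e"
  shows "ball_fraction W x e \<le> ball_fraction W x e'"
proof -
  define c where "c = e' / e"
  have c: "0 < c" "c \<le> 1" "c * e = e'" using e by (auto simp: c_def)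
  let ?f = "\<lambda>y. c *\<^sub>R y + (1 - c) *\<^sub>R x"
  have dist_f: "dist x (?f y) = c * dist x y" for y
  proof -
    have "x - ?f y = c *\<^sub>R (x - y)" by (simp add: algebra_simps)
    then show ?thesis using c by (simp add: dist_norm)
  qed
  have f_ball: "?f y \<in> ball x e' \<longleftrightarrow> y \<in> ball x e" for y
    unfolding mem_ball dist_f c(3)[symmetric] using c(1) by simp
  then have T: "?f ` (ball x e \<inter> W) = ball x e' \<inter> ?f ` W"
    by blast
  have "?f ` W \<subseteq> W"
    using W c by (auto intro!: convexD)
  then have sub: "?f ` (ball x e \<inter> W) \<subseteq> ball x e' \<inter> W"
    unfolding T by blast
  have meas: "ball x r \<inter> W \<in> lmeasurable" for r
    using W(1) by (intro fmeasurable_Int_fmeasurable lmeasurable_ball) (simp add: lmeasurable_compact fmeasurableD)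
  have "measure lebesgue (?f ` (ball x e \<inter> W)) = c ^ CARD('n) * measure lebesgue (ball x e \<inter> W)"
    using measure_lebesgue_affine[of c "(1 - c) *\<^sub>R x" "ball x e \<inter> W"] c by simp
  moreover have "measure lebesgue (?f ` (ball x e \<inter> W)) \<le> measure lebesgue (ball x e' \<inter> W)"
  proof (rule measure_mono_fmeasurable[OF sub _ meas])
    have "compact (?f ` W)"
      by (intro compact_continuous_image continuous_intros W(1))
    then show "?f ` (ball x e \<inter> W) \<in> sets lebesgue"
      unfolding T by (intro sets.Int) (simp_all add: lmeasurable_compact fmeasurableD)
  qed
  ultimately have le: "c ^ CARD('n) * measure lebesgue (ball x e \<inter> W) \<le> measure lebesgue (ball x e' \<inter> W)"
    by simp
  have ballc: "measure lebesgue (ball x e') = c ^ CARD('n) * measure lebesgue (ball x e)"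
    using content_ball_conv_unit_ball[of e' x] content_ball_conv_unit_ball[of e x] e c(3)
    by (simp add: power_mult_distrib[symmetric] mult.assoc[symmetric])
  have "measure lebesgue (ball x e) > 0" using e content_ball_pos[of e x] by simp
  then show ?thesis
    unfolding ball_fraction_def ballc using le c(1) by (simp add: field_simps)
qed

lemma ball_fraction_le_1:
  assumes "compact W"
  shows "ball_fraction W x e \<le> 1"
proof -
  have "measure lebesgue (ball x e \<inter> W) \<le> measure lebesgue (ball x e)"
    using assms by (intro measure_mono_fmeasurable sets.Int) (auto simp: lmeasurable_compact fmeasurableD)
  then show ?thesis
    unfolding ball_fraction_def by (intro divide_le_eq_1[THEN iffD2]) (auto simp: less_le)
qed

lemma ball_fraction_outside:
  assumes "closed W" "x \<notin> W"
  shows "eventually (\<lambda>e. ball_fraction W x e = 0) (at_right 0)"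
proof -
  obtain d where d: "d > 0" "ball x d \<subseteq> - W"
    using assms open_contains_ball[of "- W"] by (auto simp: open_closed)
  have "eventually (\<lambda>e. e < d) (at_right 0)"
    using d(1) by (auto simp: eventually_at_right)
  then show ?thesis
  proof eventually_elim
    case (elim e)
    then have "ball x e \<subseteq> ball x d" by (intro subset_ball) simp
    then have "ball x e \<inter> W = {}" using d(2) by blast
    then show ?case by (simp add: ball_fraction_def)
  qed
qed

lemma ball_fraction_tendsto_solid_angle:
  assumes "compact W" "convex W"
  shows "(ball_fraction W x \<longlongrightarrow> solid_angle W x) (at_right 0)"
proof -
  have "\<exists>l. (ball_fraction W x \<longlongrightarrow> l) (at_right 0)"
  proof (cases "x \<in> W")
    case False
    then show ?thesis
      using ball_fraction_outside[of W x] assms(1) compact_imp_closed tendsto_eventually by blast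
  next
    case True
    \<comment> \<open>the ball fraction increases as the radius shrinks, so it converges to its supremum\<close>
    let ?l = "SUP e\<in>{0<..}. ball_fraction W x e"
    have bdd: "bdd_above (ball_fraction W x ` {0<..})"
      using ball_fraction_le_1[OF assms(1)] by (intro bdd_aboveI2) 
    have "(ball_fraction W x \<longlongrightarrow> ?l) (at_right 0)"
    proof (rule increasing_tendsto)
      show "eventually (\<lambda>e. ball_fraction W x e \<le> ?l) (at_right 0)"
        using eventually_at_right_less[of "0::real"] 
        by eventually_elim (intro cSUP_upper bdd, simp)
    next
      fix y assume "y < ?l"
      then obtain d where d: "d > 0" "y < ball_fraction W x d"
        using less_cSUP_iff[OF _ bdd] by auto
      have "eventually (\<lambda>e. e \<in> {0<..<d}) (at_right 0)"
        using d(1) by (rule eventually_at_right_real)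
      then show "eventually (\<lambda>e. y < ball_fraction W x e) (at_right 0)"
      proof eventually_elim
        case (elim e)
        then show ?case
          using ball_fraction_antimono[OF assms True, of e d] d(2) by auto
      qed
    qed
    then show ?thesis by blast
  qed
  then obtain l where l: "(ball_fraction W x \<longlongrightarrow> l) (at_right 0)" by blast
  then have "solid_angle W x = l"
    unfolding solid_angle_def ball_fraction_def[symmetric]
    by (intro tendsto_Lim) (simp_all add: trivial_limit_at_right_real)
  with l show ?thesis by simp
qed

lemma solid_angle_eqI:
  assumes "eventually (\<lambda>e. ball_fraction W x e = c) (at_right 0)"
  shows "solid_angle W x = c"
  unfolding solid_angle_def ball_fraction_def[symmetric]
  using tendsto_eventually[OF assms] by (intro tendsto_Lim) (simp_all add: trivial_limit_at_right_real)

lemma solid_angle_outside: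
  assumes "closed W" "x \<notin> W"
  shows "solid_angle W x = 0"
  using solid_angle_eqI[OF ball_fraction_outside[OF assms]] .

lemma solid_angle_interior:
  assumes "x \<in> interior W"
  shows "solid_angle W x = 1"
proof (rule solid_angle_eqI)
  obtain d where d: "d > 0" "ball x d \<subseteq> W"
    using assms by (auto simp: mem_interior)
  have "eventually (\<lambda>e. e \<in> {0<..<d}) (at_right 0)"
    using d(1) by (rule eventually_at_right_real)
  then show "eventually (\<lambda>e. ball_fraction W x e = 1) (at_right 0)"
  proof eventually_elim
    case (elim e)
    then have "ball x e \<inter> W = ball x e" using d(2) by auto
    then show ?case using elim content_ball_pos[of e x] by (simp add: ball_fraction_def)
  qed
qed

text \<open>The number of points of the translated lattice \<open>int_lattice + v\<close> in \<open>W\<close>.\<close>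

definition lattice_count :: "(real ^ 'n) set \<Rightarrow> real ^ 'n \<Rightarrow> real" where
  "lattice_count W v = real (card {z \<in> int_lattice. z + v \<in> W})"

text \<open>The sum of the ball fractions over the lattice is the average of the count of the translated
  lattice over small translations. The finite set \<open>Z\<close> collects all lattice points that can
  contribute.\<close>

lemma sum_ball_fraction_eq_average:
  fixes W :: "(real ^ 'n) set"
  assumes W: "compact W" and e: "0 < e" "e < 1"
    and Z: "finite Z" "{z \<in> int_lattice. \<exists>v\<in>ball 0 1. z + v \<in> W} \<subseteq> Z" "Z \<subseteq> int_lattice"
  shows "integrable lebesgue (\<lambda>v. indicator (ball 0 e) v * lattice_count W v)" (is ?int)
    and "(\<Sum>z\<in>Z. ball_fraction W z e)
      = integral\<^sup>L lebesgue (\<lambda>v. indicator (ball 0 e) v * lattice_count W v) / measure lebesgue (ball (0::real^'n) e)" (is ?eq)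
proof -
  let ?A = "\<lambda>z. ball 0 e \<inter> (\<lambda>y. y - z) ` W"
  have meas: "?A z \<in> lmeasurable" for z :: "real ^ 'n"
    using compact_translation_subtract[OF W, of z]
    by (intro fmeasurable_Int_fmeasurable lmeasurable_ball) (simp add: lmeasurable_compact fmeasurableD)
  have mem: "v \<in> (\<lambda>y. y - z) ` W \<longleftrightarrow> z + v \<in> W" for v z
    by (metis (no_types, lifting) add.commute add_diff_cancel_right' diff_add_cancel image_iff)
  have *: "indicator (ball 0 e) v * lattice_count W v = (\<Sum>z\<in>Z. indicator (?A z) v)" for v :: "real ^ 'n"
  proof (cases "v \<in> ball 0 e")
    case True
    then have "{z \<in> int_lattice. z + v \<in> W} = {z \<in> Z. z + v \<in> W}"
      using Z e by (auto intro!: Z(2)[THEN subsetD])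
    moreover have "(\<Sum>z\<in>Z. indicator (?A z) v) = (\<Sum>z\<in>Z. if z + v \<in> W then 1 else 0 :: real)"
      using True by (intro sum.cong) (auto simp: indicator_def mem)
    ultimately show ?thesis
      using True Z(1) by (simp add: lattice_count_def sum.If_cases Int_def)
  qed simp
  have int: "integrable lebesgue (indicator (?A z) :: _ \<Rightarrow> real)" for z
    using meas[of z] by (intro integrable_real_indicator) (auto simp: fmeasurable_def)
  show ?int unfolding * using int by (intro Bochner_Integration.integrable_sum)
  have frac: "ball_fraction W z e = measure lebesgue (?A z) / measure lebesgue (ball (0::real^'n) e)" for z :: "real ^ 'n"
  proof -
    have "?A z = (\<lambda>y. y - z) ` (ball z e \<inter> W)"
      by (force simp: dist_norm image_iff algebra_simps norm_minus_commute)
    moreover have "measure lebesgue (ball z e) = measure lebesgue (ball (0::real^'n) e)"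
      using content_ball_conv_unit_ball[of e z] content_ball_conv_unit_ball[of e "0 :: real^'n"] e by simp
    ultimately show ?thesis
      by (simp add: ball_fraction_def measure_translation_subtract)
  qed
  have "integral\<^sup>L lebesgue (\<lambda>v. indicator (ball 0 e) v * lattice_count W v) = (\<Sum>z\<in>Z. measure lebesgue (?A z))"
    unfolding * using int by (subst Bochner_Integration.integral_sum) auto
  then show ?eq
    by (simp add: frac sum_divide_distrib)
qed

lemma fdiff_funpow_integral:
  assumes "\<And>n. integrable M (g n)"
  shows "integrable M (\<lambda>v. (fdiff ^^ k) (\<lambda>n. g n v) n) \<and>
    (fdiff ^^ k) (\<lambda>n. integral\<^sup>L M (g n)) n = integral\<^sup>L M (\<lambda>v. (fdiff ^^ k) (\<lambda>n. g n v) n)"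
proof (induction k arbitrary: n)
  case (Suc k)
  then show ?case
    unfolding fdiff_funpow_Suc by simp
qed (simp add: assms)

lemma fdiff_funpow_mult_left: "(fdiff ^^ k) (\<lambda>n. c * f n) n = c * (fdiff ^^ k) f n"
  by (induction k arbitrary: n) (simp_all add: fdiff_def algebra_simps)

text \<open>The solid angle sum of a single set.\<close>

definition lattice_angle_sum :: "(real ^ 'n) set \<Rightarrow> real" where
  "lattice_angle_sum W = (\<Sum>\<^sub>\<infinity>x\<in>int_lattice. solid_angle W x)"

lemma lattice_angle_sum_eq_sum:
  fixes W :: "(real ^ 'n) set"
  assumes "closed W" "finite Z" "int_lattice \<inter> W \<subseteq> Z" "Z \<subseteq> int_lattice"
  shows "lattice_angle_sum W = (\<Sum>z\<in>Z. solid_angle W z)"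
proof -
  have "lattice_angle_sum W = (\<Sum>\<^sub>\<infinity>z\<in>Z. solid_angle W z)"
    unfolding lattice_angle_sum_def
    using assms solid_angle_outside[OF assms(1)] by (intro infsum_cong_neutral) auto
  then show ?thesis using assms(2) by simp
qed

text \<open>The vanishing of differences passes from the counts for all translates to their averages, and
  from the averages to the limit.\<close>

lemma fdiff_lattice_angle_sum_eq_0:
  fixes W :: "nat \<Rightarrow> (real ^ 'n) set"
  assumes W: "\<And>n. compact (W n)" "\<And>n. convex (W n)"
    and count: "\<And>v. (fdiff ^^ k) (\<lambda>n. lattice_count (W n) v) = (\<lambda>_. 0)"
  shows "(fdiff ^^ k) (\<lambda>n. lattice_angle_sum (W n)) = (\<lambda>_. 0)"
proof
  fix N
  define Z where "Z = (\<lambda>n. int_lattice \<inter> {x - v |x v. x \<in> W n \<and> v \<in> cball 0 1})"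
  have finZ: "finite (Z n)" for n
    unfolding Z_def using W(1)
    by (intro finite_int_lattice_Int_bounded compact_imp_bounded compact_differences) auto
  have subZ: "{z \<in> int_lattice. \<exists>v\<in>ball 0 1. z + v \<in> W n} \<subseteq> Z n" for n
  proof
    fix z assume "z \<in> {z \<in> int_lattice. \<exists>v\<in>ball 0 1. z + v \<in> W n}"
    then obtain v where "z \<in> int_lattice" "v \<in> ball 0 1" "z + v \<in> W n" by blast
    then show "z \<in> Z n"
      unfolding Z_def mem_Collect_eq Int_iff by (intro conjI exI[of _ "z + v"] exI[of _ v]) auto
  qed
  have subZ': "int_lattice \<inter> W n \<subseteq> Z n" for n
    unfolding Z_def by (force intro: exI[of _ 0])
  have ZL: "Z n \<subseteq> int_lattice" for n unfolding Z_def by blast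
  let ?F = "\<lambda>e n. \<Sum>z\<in>Z n. ball_fraction (W n) z e"
  have "((\<lambda>e. (fdiff ^^ k) (?F e) N) \<longlongrightarrow> (fdiff ^^ k) (\<lambda>n. lattice_angle_sum (W n)) N) (at_right 0)"
  proof (rule tendsto_fdiff_funpow)
    fix n
    have "lattice_angle_sum (W n) = (\<Sum>z\<in>Z n. solid_angle (W n) z)"
      using W(1) compact_imp_closed finZ subZ' ZL by (intro lattice_angle_sum_eq_sum) auto
    then show "((\<lambda>e. ?F e n) \<longlongrightarrow> lattice_angle_sum (W n)) (at_right 0)"
      using W by (simp only:) (intro tendsto_sum ball_fraction_tendsto_solid_angle)
  qed
  moreover have "eventually (\<lambda>e. (fdiff ^^ k) (?F e) N = 0) (at_right 0)"
  proof -
    have "eventually (\<lambda>e::real. e \<in> {0<..<1}) (at_right 0)"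
      by (rule eventually_at_right_real) simp
    then show ?thesis
    proof eventually_elim
      case (elim e)
      let ?g = "\<lambda>n v. indicator (ball 0 e) v * lattice_count (W n) v"
      let ?c = "1 / measure lebesgue (ball (0::real^'n) e)"
      have e: "0 < e" "e < 1" using elim by auto
      note avg = sum_ball_fraction_eq_average[OF W(1) e finZ subZ ZL]
      have "(\<lambda>n. ?F e n) = (\<lambda>n. ?c * integral\<^sup>L lebesgue (?g n))"
        using avg(2) by simp
      then have "(fdiff ^^ k) (?F e) N = ?c * (fdiff ^^ k) (\<lambda>n. integral\<^sup>L lebesgue (?g n)) N"
        by (simp only: fdiff_funpow_mult_left)
      also have "(fdiff ^^ k) (\<lambda>n. integral\<^sup>L lebesgue (?g n)) N
          = integral\<^sup>L lebesgue (\<lambda>v. (fdiff ^^ k) (\<lambda>n. ?g n v) N)"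
        using fdiff_funpow_integral[of lebesgue ?g, OF avg(1)] by blast
      also have "\<dots> = 0"
        by (simp add: fdiff_funpow_mult_left count)
      finally show ?case by simp
    qed
  qed
  ultimately show "(fdiff ^^ k) (\<lambda>n. lattice_angle_sum (W n)) N = 0"
    using tendsto_unique[OF _ _ tendsto_eventually] trivial_limit_at_right_real by blast
qed

section \<open>Lattice points in dilates of rational polytopes\<close>

text \<open>The slices at positive height of the cone over a polytope placed at height \<open>1\<close> are the dilates of
  the polytope.\<close>

lemma mem_convex_cone_hull_height:
  fixes V :: "(real ^ 'n) set"
  assumes "r > 0"
  shows "(x, r) \<in> convex_cone hull (V \<times> {1}) \<longleftrightarrow> x \<in> dilate r (convex hull V)"
proof (cases "V = {}")
  case False
  then have "convex_cone hull (V \<times> {1}) =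
      (\<Union>y\<in>(convex hull V) \<times> {1}. \<Union>c\<in>{0..}. {c *\<^sub>R y})"
    by (subst convex_cone_hull_convex_hull_nonempty) (simp_all add: convex_hull_Times)
  then show ?thesis using assms by (auto simp: image_iff)
qed (use assms in \<open>auto simp: zero_prod_def\<close>)

text \<open>Ehrhart's theorem for real dilations and arbitrary translates of a lattice polytope, in terms
  of differences.\<close>

lemma fdiff_lattice_count_dilate:
  fixes V :: "(real ^ 'n) set"
  assumes V: "finite V" "V \<subseteq> int_lattice" and s: "s > 0"
  shows "(fdiff ^^ Suc CARD('n)) (\<lambda>n. lattice_count (dilate (s + real n) (convex hull V)) u) = (\<lambda>_. 0)"
proof -
  \<comment> \<open>the translated lattice placed at height \<open>s + n\<close> in one more dimension\<close>
  define X where "X = (\<lambda>n. (\<lambda>z. (z + u, s + real n)) ` (int_lattice :: (real ^ 'n) set))"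
  let ?S = "V \<times> {1::real}"
  let ?L = "\<lambda>n. {z \<in> int_lattice. z + u \<in> dilate (s + real n) (convex hull V)}"
  have cone: "X n \<inter> convex_cone hull ?S = (\<lambda>z. (z + u, s + real n)) ` ?L n" for n
    using s mem_convex_cone_hull_height[of "s + real n" _ V]
    by (auto simp: X_def add_pos_nonneg simp del: image_iff)
  have "finite (?L n)" for n
  proof -
    have "bounded ((\<lambda>x. x - u) ` dilate (s + real n) (convex hull V))"
      using V(1) by (intro bounded_translation_minus bounded_scaling bounded_convex_hull finite_imp_bounded)
    moreover have "?L n = int_lattice \<inter> (\<lambda>x. x - u) ` dilate (s + real n) (convex hull V)"
      by (force simp: image_iff algebra_simps)
    ultimately show ?thesis using finite_int_lattice_Int_bounded by simp
  qed
  then have fin: "finite (X n \<inter> convex_cone hull ?S)" for n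
    unfolding cone by simp
  have "card (X n \<inter> convex_cone hull ?S) = card (?L n)" for n
    unfolding cone by (intro card_image) (auto simp: inj_on_def)
  moreover have "(fdiff ^^ DIM((real ^ 'n) \<times> real)) (\<lambda>n. real (card (X n \<inter> convex_cone hull ?S))) = (\<lambda>_. 0)"
  proof (rule fdiff_card_cone_slices[where h = snd])
    show "x + w \<in> X (Suc n) \<longleftrightarrow> x \<in> X n" if w: "w \<in> ?S" for w x n
    proof -
      obtain v where v: "w = (v, 1)" "v \<in> int_lattice" using w V(2) by auto
      obtain y r where x: "x = (y, r)" by (cases x)
      have "(y, r) \<in> X n \<longleftrightarrow> y - u \<in> int_lattice \<and> r = s + real n" for y r n
        by (auto simp: X_def image_iff intro!: bexI[of _ "y - u"])
      moreover have "y + v - u \<in> int_lattice \<longleftrightarrow> y - u \<in> int_lattice"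
        using int_lattice_add[of "y - u" v] int_lattice_diff[of "y + v - u" v] v(2)
        by (auto simp: algebra_simps)
      ultimately show ?thesis by (auto simp: x v(1))
    qed
    show "linear (snd :: (real ^ 'n) \<times> real \<Rightarrow> real)"
      by (rule bounded_linear.linear[OF bounded_linear_snd])
  qed (use V(1) fin s in \<open>auto simp: X_def\<close>)
  ultimately show ?thesis by (simp add: lattice_count_def)
qed

lemma rational_common_denominator:
  assumes "finite R" "R \<subseteq> \<rat>"
  shows "\<exists>m::nat. m > 0 \<and> (\<forall>q\<in>R. real m * q \<in> \<int>)"
  using assms
proof (induction R)
  case (insert q R)
  then obtain m where m: "m > 0" "\<forall>q\<in>R. real m * q \<in> \<int>" by auto
  from insert.prems have "q \<in> \<rat>" by simp
  then obtain k b where q: "b > 0" "q = of_int k / of_int b"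
    using Rats_cases' by metis
  have "real (m * nat b) * q = of_int (int m * k)"
    using q by (simp add: field_simps)
  then have "real (m * nat b) * q \<in> \<int>"
    by (metis Ints_of_int)
  moreover have "real (m * nat b) * p \<in> \<int>" if "p \<in> R" for p
  proof -
    have "real (m * nat b) * p = of_int b * (real m * p)" using q by simp
    then show ?thesis using m that by (metis Ints_mult Ints_of_int)
  qed
  ultimately show ?case
    using m(1) q(1) by (intro exI[of _ "m * nat b"]) (simp del: of_nat_mult)
qed auto

lemma polytope_extreme_points:
  fixes P :: "'a::euclidean_space set"
  assumes "polytope P"
  shows "finite {v. v extreme_point_of P}" and "P = convex hull {v. v extreme_point_of P}"
proof -
  show "finite {v. v extreme_point_of P}"
    by (rule finite_polyhedron_extreme_points[OF polytope_imp_polyhedron[OF assms]])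
  show "P = convex hull {v. v extreme_point_of P}"
    by (rule Krein_Milman_Minkowski[OF polytope_imp_compact[OF assms] polytope_imp_convex[OF assms]])
qed

text \<open>The vertices have a common denominator, so the minimum that defines \<open>denominator\<close> is attained.\<close>

lemma denominator_props:
  fixes P :: "(real ^ 'n) set"
  assumes "rational_polytope P"
  shows "denominator P > 0"
    and "v extreme_point_of dilate (real (denominator P)) P \<Longrightarrow> v \<in> int_lattice"
proof -
  have P: "polytope P" using assms by (simp add: rational_polytope_def)
  let ?E = "{v. v extreme_point_of P}"
  have E: "finite ?E" "P = convex hull ?E"
    by (rule polytope_extreme_points[OF P])+
  define R where "R = (\<lambda>(v, i). v $ i) ` (?E \<times> (UNIV :: 'n set))"
  have "finite R" unfolding R_def using E(1) by simp
  moreover have "R \<subseteq> \<rat>"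
    using assms by (auto simp: R_def rational_polytope_def rational_vector_def)
  ultimately obtain m :: nat where m0: "m > 0" and "\<forall>q\<in>R. real m * q \<in> \<int>"
    using rational_common_denominator by blast
  then have m: "real m * v $ i \<in> \<int>" if "v \<in> ?E" for v i
    using that unfolding R_def by force
  have "v \<in> int_lattice" if "v extreme_point_of dilate (real m) P" for v
  proof -
    have "dilate (real m) P = convex hull (dilate (real m) ?E)"
      using E(2) by (metis convex_hull_scaling)
    with that have "v \<in> dilate (real m) ?E"
      using extreme_point_of_convex_hull by metis
    then show ?thesis using m by (auto simp: int_lattice_def)
  qed
  with m0 have "\<exists>m. 0 < m \<and> (\<forall>v. v extreme_point_of (dilate (real m) P) \<longrightarrow> v \<in> int_lattice)"
    by blast
  from LeastI_ex[OF this]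
  show "denominator P > 0"
    and "v extreme_point_of dilate (real (denominator P)) P \<Longrightarrow> v \<in> int_lattice"
    unfolding denominator_def by blast+
qed

lemma fdiff_lattice_count_rational_polytope:
  fixes P :: "(real ^ 'n) set"
  assumes P: "rational_polytope P" and r: "r > 0"
  shows "(fdiff ^^ Suc CARD('n))
    (\<lambda>n. lattice_count (dilate (r + real n * real (denominator P)) P) u) = (\<lambda>_. 0)"
proof -
  let ?m = "real (denominator P)"
  let ?Q = "dilate ?m P"
  let ?V = "{v. v extreme_point_of ?Q}"
  have m: "?m > 0" using denominator_props(1)[OF P] by simp
  have "polytope P" using P by (simp add: rational_polytope_def)
  then have Q: "polytope ?Q" by (simp add: polytope_scaling)
  then have V: "finite ?V" "?Q = convex hull ?V"
    by (rule polytope_extreme_points)+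
  have "?V \<subseteq> int_lattice" using denominator_props(2)[OF P] by blast
  moreover have "dilate (r + real n * ?m) P = dilate (r / ?m + real n) (convex hull ?V)" for n
  proof -
    have "(r / ?m + real n) * ?m = r + real n * ?m" using m by (simp add: field_simps)
    then show ?thesis
      unfolding V(2)[symmetric] image_image scaleR_scaleR by simp
  qed
  ultimately show ?thesis
    using fdiff_lattice_count_dilate[OF V(1), of "r / ?m"] r m by simp
qed

section \<open>Comparison of the two counting functions\<close>

lemma ehrhart_eq_lattice_count: "ehrhart P t = lattice_count (dilate t P) 0"
  by (simp add: ehrhart_def lattice_count_def Int_def conj_commute)

lemma dilate_plus_dilate_translate:
  fixes P :: "(real ^ 'n) set"
  assumes "convex P" "t > 0" "\<tau> \<ge> 0"
  shows "dilate t P + dilate \<tau> ((\<lambda>x. x - a) ` P) = (\<lambda>x. x - \<tau> *\<^sub>R a) ` dilate (t + \<tau>) P"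
proof (intro equalityI subsetI)
  fix z assume "z \<in> dilate t P + dilate \<tau> ((\<lambda>x. x - a) ` P)"
  then obtain x y where xy: "x \<in> P" "y \<in> P" "z = t *\<^sub>R x + \<tau> *\<^sub>R (y - a)"
    by (auto elim!: set_plus_elim)
  have "\<exists>w\<in>P. t *\<^sub>R x + \<tau> *\<^sub>R y = (t + \<tau>) *\<^sub>R w"
  proof
    show "(t / (t + \<tau>)) *\<^sub>R x + (\<tau> / (t + \<tau>)) *\<^sub>R y \<in> P"
      using assms xy by (intro convexD) (auto simp: add_divide_distrib[symmetric])
    show "t *\<^sub>R x + \<tau> *\<^sub>R y = (t + \<tau>) *\<^sub>R ((t / (t + \<tau>)) *\<^sub>R x + (\<tau> / (t + \<tau>)) *\<^sub>R y)"
      using assms by (simp add: scaleR_add_right)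
  qed
  then show "z \<in> (\<lambda>x. x - \<tau> *\<^sub>R a) ` dilate (t + \<tau>) P"
    by (auto simp: xy(3) algebra_simps)
next
  fix z assume "z \<in> (\<lambda>x. x - \<tau> *\<^sub>R a) ` dilate (t + \<tau>) P"
  then obtain x where "x \<in> P" "z = t *\<^sub>R x + \<tau> *\<^sub>R (x - a)"
    by (auto simp: algebra_simps)
  then show "z \<in> dilate t P + dilate \<tau> ((\<lambda>x. x - a) ` P)"
    by (auto intro!: set_plus_intro)
qed

lemma solid_angle_sum_eq_lattice_angle_sum:
  "solid_angle_sum P R t = lattice_angle_sum (dilate t P + R)"
  by (simp add: solid_angle_sum_def lattice_angle_sum_def)

lemma fdiff_solid_angle_sum:
  fixes P :: "(real ^ 'n) set"
  assumes P: "rational_polytope P" and t: "t > 0" "\<tau> > 0"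
  shows "(fdiff ^^ Suc CARD('n)) (\<lambda>n. solid_angle_sum P (dilate \<tau> ((\<lambda>x. x - a) ` P))
    (t + real n * real (denominator P))) = (\<lambda>_. 0)"
proof -
  let ?m = "real (denominator P)"
  have conv: "convex P" and comp: "compact P"
    using P by (simp_all add: rational_polytope_def polytope_imp_convex polytope_imp_compact)
  \<comment> \<open>by convexity the Minkowski sum is again a translated dilate of \<open>P\<close>\<close>
  define W where "W = (\<lambda>n. (\<lambda>x. x - \<tau> *\<^sub>R a) ` dilate ((t + \<tau>) + real n * ?m) P)"
  have eq: "dilate (t + real n * ?m) P + dilate \<tau> ((\<lambda>x. x - a) ` P) = W n" for n
    using dilate_plus_dilate_translate[OF conv, of "t + real n * ?m" \<tau> a] t
    by (simp add: W_def add_ac add_pos_nonneg)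
  have "(fdiff ^^ Suc CARD('n)) (\<lambda>n. lattice_angle_sum (W n)) = (\<lambda>_. 0)"
  proof (rule fdiff_lattice_angle_sum_eq_0)
    show "compact (W n)" for n
      unfolding W_def by (intro compact_translation_subtract compact_scaling comp)
    show "convex (W n)" for n
      unfolding W_def by (intro convex_translation_subtract convex_scaling conv)
    \<comment> \<open>the translation by \<open>- \<tau> a\<close> is absorbed in the translation of the lattice\<close>
    have "z + v \<in> W n \<longleftrightarrow> z + (v + \<tau> *\<^sub>R a) \<in> dilate ((t + \<tau>) + real n * ?m) P" for z v n
    proof -
      have "z + v = x - \<tau> *\<^sub>R a \<longleftrightarrow> z + (v + \<tau> *\<^sub>R a) = x" for x
        by (auto simp: algebra_simps)
      then show ?thesis unfolding W_def by (subst image_iff) auto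
    qed
    then have "lattice_count (W n) v = lattice_count (dilate ((t + \<tau>) + real n * ?m) P) (v + \<tau> *\<^sub>R a)" for n v
      unfolding lattice_count_def by simp
    then show "(fdiff ^^ Suc CARD('n)) (\<lambda>n. lattice_count (W n) v) = (\<lambda>_. 0)" for v
      using fdiff_lattice_count_rational_polytope[OF P, of "t + \<tau>" "v + \<tau> *\<^sub>R a"] t by simp
  qed
  then show ?thesis by (simp only: solid_angle_sum_eq_lattice_angle_sum eq)
qed

text \<open>For small \<open>\<tau>\<close> every lattice point of \<open>t P\<close> is interior to the enlarged set, since \<open>\<tau> (P - a)\<close> is a
  neighbourhood of \<open>0\<close>, and the finitely many other lattice points near \<open>t P\<close> are not reached.\<close>

lemma eventually_solid_angle_sum_eq_ehrhart:
  fixes P :: "(real ^ 'n) set"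
  assumes P: "compact P" "convex P" and a: "a \<in> interior P" and t: "t > 0"
  shows "eventually (\<lambda>\<tau>. solid_angle_sum P (dilate \<tau> ((\<lambda>x. x - a) ` P)) t = ehrhart P t) (at_right 0)"
proof -
  let ?W = "\<lambda>\<tau>. dilate t P + dilate \<tau> ((\<lambda>x. x - a) ` P)"
  have comp: "compact (dilate t P)" using P(1) by (rule compact_scaling)
  have "bounded ((\<lambda>x. x - a) ` P)"
    using P(1) by (intro bounded_translation_minus compact_imp_bounded)
  then obtain C where C: "C > 0" "\<And>y. y \<in> P \<Longrightarrow> norm (y - a) \<le> C"
    unfolding bounded_pos by auto
  obtain r where r: "r > 0" "ball a r \<subseteq> P" using a by (auto simp: mem_interior)
  define Z where "Z = int_lattice \<inter> {x + y |x y. x \<in> dilate t P \<and> y \<in> cball 0 C}"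
  have finZ: "finite Z"
    unfolding Z_def using comp
    by (intro finite_int_lattice_Int_bounded compact_imp_bounded compact_sums) auto
  have away: "eventually (\<lambda>\<tau>. z \<notin> ?W \<tau>) (at_right 0)" if z: "z \<notin> dilate t P" for z
  proof -
    obtain d where d: "d > 0" "ball z d \<subseteq> - dilate t P"
      using z open_contains_ball[THEN iffD1, OF open_Compl[OF compact_imp_closed[OF comp]]] by blast
    have "eventually (\<lambda>\<tau>. \<tau> \<in> {0<..<d / C}) (at_right 0)"
      using d C by (intro eventually_at_right_real) simp
    then show ?thesis
    proof eventually_elim
      case (elim \<tau>)
      show ?case
      proof
        assume "z \<in> ?W \<tau>"
        then obtain x y where xy: "x \<in> dilate t P" "y \<in> P" "z = x + \<tau> *\<^sub>R (y - a)"
          by (auto elim!: set_plus_elim)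
        have "dist z x = \<tau> * norm (y - a)" using elim by (simp add: xy(3) dist_norm)
        also have "\<dots> \<le> \<tau> * C" using elim C(2)[OF xy(2)] by (intro mult_left_mono) auto
        also have "\<dots> < d" using elim C(1) by (simp add: field_simps)
        finally have "x \<in> ball z d" by simp
        then show False using d(2) xy(1) by blast
      qed
    qed
  qed
  \<comment> \<open>\<open>Z\<close> contains all lattice points reached for \<open>\<tau> < 1\<close>; finiteness makes one bound work for all\<close>
  have "eventually (\<lambda>\<tau>. \<forall>z\<in>Z - dilate t P. z \<notin> ?W \<tau>) (at_right 0)"
    using finZ away by (intro eventually_ball_finite) auto
  moreover have "eventually (\<lambda>\<tau>::real. \<tau> \<in> {0<..<1}) (at_right 0)"
    by (intro eventually_at_right_real) simp
  ultimately show ?thesis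
  proof eventually_elim
    case (elim \<tau>)
    have \<tau>: "0 < \<tau>" "\<tau> < 1" using elim by auto
    have "compact (?W \<tau>)"
      unfolding dilate_plus_dilate_translate[OF P(2) t less_imp_le[OF \<tau>(1)]]
      by (intro compact_translation_subtract compact_scaling P(1))
    then have closed: "closed (?W \<tau>)" by (rule compact_imp_closed)
    have WZ: "int_lattice \<inter> ?W \<tau> \<subseteq> Z"
    proof
      fix z assume z: "z \<in> int_lattice \<inter> ?W \<tau>"
      then obtain x y where xy: "x \<in> dilate t P" "y \<in> P" "z = x + \<tau> *\<^sub>R (y - a)"
        by (auto elim!: set_plus_elim)
      have "norm (\<tau> *\<^sub>R (y - a)) \<le> 1 * C"
        unfolding norm_scaleR using \<tau> C(1) C(2)[OF xy(2)] by (intro mult_mono) auto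
      then have "\<tau> *\<^sub>R (y - a) \<in> cball 0 C" by simp
      then show "z \<in> Z" using z xy unfolding Z_def by blast
    qed
    have ang: "solid_angle (?W \<tau>) z = (if z \<in> dilate t P then 1 else 0)" if z: "z \<in> Z" for z
    proof (cases "z \<in> dilate t P")
      case True
      have "ball z (\<tau> * r) \<subseteq> ?W \<tau>"
      proof
        fix x assume "x \<in> ball z (\<tau> * r)"
        then have "norm ((1 / \<tau>) *\<^sub>R (x - z)) < r"
          unfolding norm_scaleR using \<tau> by (simp add: dist_norm norm_minus_commute field_simps)
        then have "a + (1 / \<tau>) *\<^sub>R (x - z) \<in> P"
          using r(2) by (intro subsetD[OF r(2)]) (simp add: dist_norm)
        then have "\<tau> *\<^sub>R (a + (1 / \<tau>) *\<^sub>R (x - z) - a) \<in> dilate \<tau> ((\<lambda>x. x - a) ` P)" by blast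
        then have "x - z \<in> dilate \<tau> ((\<lambda>x. x - a) ` P)" using \<tau> by simp
        from set_plus_intro[OF True this] show "x \<in> ?W \<tau>" by simp
      qed
      then have "z \<in> interior (?W \<tau>)"
        using \<tau> r(1) by (auto simp: mem_interior intro!: exI[of _ "\<tau> * r"])
      then show ?thesis using True solid_angle_interior by simp
    next
      case False
      then show ?thesis using elim z solid_angle_outside[OF closed] by auto
    qed
    have "dilate t P \<inter> int_lattice \<subseteq> Z"
    proof
      fix z assume z: "z \<in> dilate t P \<inter> int_lattice"
      have "z = z + 0" "0 \<in> cball (0 :: real ^ 'n) C" using C(1) by simp_all
      then show "z \<in> Z" using z unfolding Z_def by blast
    qed
    then have "Z \<inter> {z. z \<in> dilate t P} = dilate t P \<inter> int_lattice"
      unfolding Z_def by blast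
    moreover have "solid_angle_sum P (dilate \<tau> ((\<lambda>x. x - a) ` P)) t = (\<Sum>z\<in>Z. solid_angle (?W \<tau>) z)"
      unfolding solid_angle_sum_eq_lattice_angle_sum
      using closed finZ WZ by (intro lattice_angle_sum_eq_sum) (auto simp: Z_def)
    ultimately show ?case
      using finZ by (simp add: ang ehrhart_def sum.If_cases cong: sum.cong)
  qed
qed

theorem theorem6p1:
  fixes P :: "(real ^ 'n) set" and a :: "real ^ 'n"
  assumes "rational_polytope P"
    and "aff_dim P = int CARD('n)"
    and "rational_vector a"
    and "a \<in> interior P"
  shows "(\<forall>t>0. ((\<lambda>\<tau>. solid_angle_sum P (dilate \<tau> ((\<lambda>x. x - a) ` P)) t)
                    \<longlongrightarrow> ehrhart P t) (at_right 0)) \<and>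
         (\<forall>k\<le>CARD('n). \<forall>t>0.
            ((\<lambda>\<tau>. solid_angle_coeff P (dilate \<tau> ((\<lambda>x. x - a) ` P)) k t)
               \<longlongrightarrow> ehrhart_coeff P k t) (at_right 0))"
proof -
  have P: "compact P" "convex P"
    using assms(1) by (simp_all add: rational_polytope_def polytope_imp_compact polytope_imp_convex)
  have lim: "((\<lambda>\<tau>. solid_angle_sum P (dilate \<tau> ((\<lambda>x. x - a) ` P)) t) \<longlongrightarrow> ehrhart P t) (at_right 0)"
    if "t > 0" for t
    using eventually_solid_angle_sum_eq_ehrhart[OF P assms(4) that] by (rule tendsto_eventually)
  have "((\<lambda>\<tau>. solid_angle_coeff P (dilate \<tau> ((\<lambda>x. x - a) ` P)) k t)
      \<longlongrightarrow> ehrhart_coeff P k t) (at_right 0)" if k: "k \<le> CARD('n)" "t > 0" for k t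
    unfolding solid_angle_coeff_def ehrhart_coeff_def
  proof (rule tendsto_quasi_coeff[OF _ _ _ lim k])
    show "real (denominator P) > 0" using denominator_props(1)[OF assms(1)] by simp
    show "eventually (\<lambda>\<tau>. \<forall>t>0. (fdiff ^^ Suc CARD('n)) (\<lambda>n. solid_angle_sum P
        (dilate \<tau> ((\<lambda>x. x - a) ` P)) (t + real n * real (denominator P))) = (\<lambda>_. 0)) (at_right 0)"
      using eventually_at_right_less[of "0::real"]
      by eventually_elim (intro allI impI fdiff_solid_angle_sum[OF assms(1)])
    show "(fdiff ^^ Suc CARD('n)) (\<lambda>n. ehrhart P (t + real n * real (denominator P))) = (\<lambda>_. 0)"
      if "t > 0" for t
      unfolding ehrhart_eq_lattice_count
      by (rule fdiff_lattice_count_rational_polytope[OF assms(1) that])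
  qed
  with lim show ?thesis by blast
qed

end
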